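(* Let $m$ be an odd integer such that $q=2m^2-1$ is a prime power. Let $\omega$ be a fixed primitive element of $\mathbb{F}_{q^2}$, let $X_0=\{0\}$, and assume there are subsets $X_1,X_2,X_3,X_4$ of $\mathbb{F}_{q^2}$ partitioning $\mathbb{F}_{q^2}\setminus\{0\}$ such that: (1) $X_1=\omega^{2m^2}X_3$ and $X_2=\omega^{2m^2}X_4$; (2) each $X_i$ ($i=1,2,3,4$) is a union of cosets of the subgroup $C_0^{(4m^2,q^2)}=\langle\omega^{4m^2}\rangle$ of $\mathbb{F}_{q^2}^*$; (3) with $R_i=\{(x,y)\in\mathbb{F}_{q^2}^2: x-y\in X_i\}$, $(\mathbb{F}_{q^2},\{R_i\}_{i=0}^4)$ is a four-class association scheme whose first eigenmatrix is the following table: there is $\tau\in\{1,-1\}$ such that, setting $Y_0=\{0\}$ and $Y_j=\omega^{-m^2\tau}X_j^q$ ($j=1,2,3,4$), where $X_j^q=\{x^q:x\in X_j\}$, and writing $g=G_q(\eta)$, for every $a\in Y_j$ the value $\psi_{\mathbb{F}_{q^2}}(aX_i)=\sum_{x\in X_i}\psi_{\mathbb{F}_{q^2}}(ax)$ is given by: - $a\in Y_0$: $m(m^2-1)(m-1)$, $m(m^2-1)(m+1)$, $m(m^2-1)(m-1)$, $m(m^2-1)(m+1)$ for $i=1,2,3,4$ respectively; - $a\in Y_1$: $\frac{m^2+m-1}{2}-\frac{m}{2}g$, $\frac{-m^2-m}{2}-\frac{m+1}{2}g$, $\frac{m^2+m-1}{2}+\frac{m}{2}g$, $\frac{-m^2-m}{2}+\frac{m+1}{2}g$;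 - $a\in Y_2$: $\frac{-m^2+m}{2}-\frac{m-1}{2}g$, $\frac{m^2-m-1}{2}+\frac{m}{2}g$, $\frac{-m^2+m}{2}+\frac{m-1}{2}g$, $\frac{m^2-m-1}{2}-\frac{m}{2}g$; - $a\in Y_3$: $\frac{m^2+m-1}{2}+\frac{m}{2}g$, $\frac{-m^2-m}{2}+\frac{m+1}{2}g$, $\frac{m^2+m-1}{2}-\frac{m}{2}g$, $\frac{-m^2-m}{2}-\frac{m+1}{2}g$; - $a\in Y_4$: $\frac{-m^2+m}{2}+\frac{m-1}{2}g$, $\frac{m^2-m-1}{2}-\frac{m}{2}g$, $\frac{-m^2+m}{2}-\frac{m-1}{2}g$, $\frac{m^2-m-1}{2}+\frac{m}{2}g$. Then there exists a regular Hadamard matrix of order $n=4m^2$.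
   Context: For a prime power $q=p^f$, the canonical additive character of $\mathbb{F}_q$ is $\psi_{\mathbb{F}_q}(x)=\exp(2\pi i\,\mathrm{Tr}_{q/p}(x)/p)$ where $\mathrm{Tr}_{q/p}(x)=x+x^p+\dots+x^{p^{f-1}}$. For a multiplicative character $\chi$ of $\mathbb{F}_q$, the Gauss sum is $G_q(\chi)=\sum_{x\in\mathbb{F}_q^*}\chi(x)\psi_{\mathbb{F}_q}(x)$; $\eta$ denotes the quadratic character of $\mathbb{F}_q$. For $e\mid q^2-1$, $C_i^{(e,q^2)}=\omega^i\langle\omega^e\rangle$. A $d$-class association scheme on a finite set $X$ is a partition $R_0=\{(x,x)\},R_1,\dots,R_d$ of $X\times X$ such that each transpose ${}^tR_i$ is some $R_{i'}$ and, for all $i,j,k$, the number of $z$ with $(x,z)\in R_i,(z,y)\in R_j$ depends only on $k$ for $(x,y)\in R_k$; its first eigenmatrix $P$ is defined by $(A_0,\dots,A_d)=(E_0,\dots,E_d)P$, where $A_i$ are the adjacency matrices and $E_j$ the primitive idempotents of the Bose–Mesner algebra (for the translation scheme here its entries are the character sums $\psi_{\mathbb{F}_{q^2}}(aX_i)$). An Hadamard matrix of order $n$ is an $n\times n$ $\{1,-1\}$-matrix $H$ with $HH^{\top}=nI_n$; it is regular if $H\mathbf{1}_n=r\mathbf{1}_n$ for some positive integer $r$. *)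

theory Defs
  imports "HOL-Analysis.Analysis" "Jordan_Normal_Form.Matrix"
begin

text \<open>
  Finite fields: the ambient field is a type of class \<open>field\<close> and \<open>finite\<close> whose characteristic
  is the prime \<open>p\<close>. Its subfield with \<open>q\<close> elements (if there is one) is the set of roots of
  \<open>x ^ q - x\<close>, and the additive character of the field with \<open>p ^ f\<close> elements is meaningful on that
  subfield. Below, the ambient field itself is the case \<open>q ^ 2\<close> in place of \<open>q\<close>, that is
  \<open>2 * f\<close> in place of \<open>f\<close>.
\<close>

definition subfield_of_order :: "nat \<Rightarrow> 'a::field set" where
  "subfield_of_order q = {x. x ^ q = x}"

definition abs_trace :: "nat \<Rightarrow> nat \<Rightarrow> 'a::field \<Rightarrow> 'a" where
  "abs_trace p f x = (\<Sum>i<f. x ^ (p ^ i))"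

text \<open>The representative in \<open>{0..<p}\<close> of an element of the prime field.\<close>

definition prime_field_rep :: "nat \<Rightarrow> 'a::field \<Rightarrow> nat" where
  "prime_field_rep p t = (THE k. k < p \<and> of_nat k = t)"

definition add_char :: "nat \<Rightarrow> nat \<Rightarrow> 'a::field \<Rightarrow> complex" where
  "add_char p f x =
     exp (2 * of_real pi * \<i> * of_nat (prime_field_rep p (abs_trace p f x)) / of_nat p)"

definition quadratic_char :: "nat \<Rightarrow> 'a::field \<Rightarrow> complex" where
  "quadratic_char q x =
     (if x = 0 then 0 else if \<exists>y\<in>subfield_of_order q. x = y ^ 2 then 1 else - 1)"

definition gauss_sum :: "nat \<Rightarrow> nat \<Rightarrow> ('a::field \<Rightarrow> complex) \<Rightarrow> complex" where
  "gauss_sum p f h = (\<Sum>x\<in>subfield_of_order (p ^ f) - {0}. h x * add_char p f x)"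

definition primitive_element :: "'a::field \<Rightarrow> bool" where
  "primitive_element \<omega> \<longleftrightarrow> \<omega> \<noteq> 0 \<and> (\<forall>x. x \<noteq> 0 \<longrightarrow> (\<exists>k::nat. x = \<omega> ^ k))"

definition cyclotomic_class :: "'a::field \<Rightarrow> int \<Rightarrow> int \<Rightarrow> 'a set" where
  "cyclotomic_class \<omega> e i = range (\<lambda>k::int. \<omega> powi i * (\<omega> powi e) powi k)"

text \<open>Association schemes on the point set \<open>UNIV :: 'x set\<close>.\<close>

definition association_scheme :: "nat \<Rightarrow> (nat \<Rightarrow> ('x::finite \<times> 'x) set) \<Rightarrow> bool" where
  "association_scheme d R \<longleftrightarrow>
     R 0 = Id \<and>
     (\<forall>i\<le>d. R i \<noteq> {}) \<and> disjoint_family_on R {..d} \<and> (\<Union>i\<le>d. R i) = UNIV \<and>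
     (\<forall>i\<le>d. \<exists>i'\<le>d. (R i)\<inverse> = R i') \<and>
     (\<forall>i\<le>d. \<forall>j\<le>d. \<forall>k\<le>d. \<exists>n. \<forall>(x, y)\<in>R k.
        card {z. (x, z) \<in> R i \<and> (z, y) \<in> R j} = n)"

definition adjacency_matrix :: "('x::finite \<times> 'x) set \<Rightarrow> complex ^ 'x ^ 'x" where
  "adjacency_matrix S = (\<chi> x y. if (x, y) \<in> S then 1 else 0)"

definition complex_combination ::
    "nat \<Rightarrow> (nat \<Rightarrow> complex) \<Rightarrow> (nat \<Rightarrow> complex ^ 'x ^ 'x) \<Rightarrow> complex ^ 'x ^ ('x::finite)" where
  "complex_combination d c M = (\<chi> x y. \<Sum>i\<le>d. c i * vec_nth (vec_nth (M i) x) y)"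

definition bose_mesner ::
    "nat \<Rightarrow> (nat \<Rightarrow> ('x::finite \<times> 'x) set) \<Rightarrow> (complex ^ 'x ^ 'x) set" where
  "bose_mesner d R = range (\<lambda>c. complex_combination d c (\<lambda>i. adjacency_matrix (R i)))"

definition primitive_idempotents ::
    "(complex ^ 'x ^ 'x) set \<Rightarrow> (complex ^ 'x ^ ('x::finite)) set" where
  "primitive_idempotents \<A> =
     {E \<in> \<A>. E \<noteq> 0 \<and> E ** E = E \<and>
        (\<forall>F\<in>\<A>. F ** F = F \<and> E ** F = F \<and> F ** E = F \<longrightarrow> F = 0 \<or> F = E)}"

text \<open>\<open>P j i\<close> is the entry in row \<open>j\<close> (idempotent) and column \<open>i\<close> (relation).\<close>

definition is_first_eigenmatrix ::
    "nat \<Rightarrow> (nat \<Rightarrow> ('x::finite \<times> 'x) set) \<Rightarrow> (nat \<Rightarrow> nat \<Rightarrow> complex) \<Rightarrow> bool" where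
  "is_first_eigenmatrix d R P \<longleftrightarrow>
     (\<exists>E. bij_betw E {..d} (primitive_idempotents (bose_mesner d R)) \<and>
          (\<forall>i\<le>d. adjacency_matrix (R i) = complex_combination d (\<lambda>j. P j i) E))"

definition translation_relation :: "'a::field set \<Rightarrow> ('a \<times> 'a) set" where
  "translation_relation S = {(x, y). x - y \<in> S}"

text \<open>
  The prescribed eigenmatrix, with rows and columns indexed from \<open>0\<close>; column \<open>0\<close> belongs to the
  identity relation.
\<close>

definition eigen_table :: "complex \<Rightarrow> complex \<Rightarrow> nat \<Rightarrow> nat \<Rightarrow> complex" where
  "eigen_table m g j i =
    [[1, m * (m^2 - 1) * (m - 1), m * (m^2 - 1) * (m + 1),
         m * (m^2 - 1) * (m - 1), m * (m^2 - 1) * (m + 1)],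
     [1, (m^2 + m - 1) / 2 - m / 2 * g, (- (m^2) - m) / 2 - (m + 1) / 2 * g,
         (m^2 + m - 1) / 2 + m / 2 * g, (- (m^2) - m) / 2 + (m + 1) / 2 * g],
     [1, (- (m^2) + m) / 2 - (m - 1) / 2 * g, (m^2 - m - 1) / 2 + m / 2 * g,
         (- (m^2) + m) / 2 + (m - 1) / 2 * g, (m^2 - m - 1) / 2 - m / 2 * g],
     [1, (m^2 + m - 1) / 2 + m / 2 * g, (- (m^2) - m) / 2 + (m + 1) / 2 * g,
         (m^2 + m - 1) / 2 - m / 2 * g, (- (m^2) - m) / 2 - (m + 1) / 2 * g],
     [1, (- (m^2) + m) / 2 + (m - 1) / 2 * g, (m^2 - m - 1) / 2 - m / 2 * g,
         (- (m^2) + m) / 2 - (m - 1) / 2 * g, (m^2 - m - 1) / 2 + m / 2 * g]] ! j ! i"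

definition hadamard_matrix :: "nat \<Rightarrow> int mat \<Rightarrow> bool" where
  "hadamard_matrix n H \<longleftrightarrow>
     H \<in> carrier_mat n n \<and> elements_mat H \<subseteq> {1, - 1} \<and>
     H * transpose_mat H = of_nat n \<cdot>\<^sub>m 1\<^sub>m n"

definition regular_hadamard_matrix :: "nat \<Rightarrow> int mat \<Rightarrow> bool" where
  "regular_hadamard_matrix n H \<longleftrightarrow>
     hadamard_matrix n H \<and>
     (\<exists>r>0. H *\<^sub>v Matrix.vec n (\<lambda>_. 1) = r \<cdot>\<^sub>v Matrix.vec n (\<lambda>_. 1))"

end

theory Submission
  imports Defs "HOL-Number_Theory.Residues"
begin

text \<open>
  Put \<open>\<beta> = \<omega> powi (- (m\<^sup>2 * \<tau>))\<close>, so that \<open>\<beta> ^ q = - \<beta>\<close>, and let \<open>tr\<close> be the relative trace to the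
  subfield of order \<open>q\<close>. The matrix \<open>S k j = \<eta> (tr (\<beta> * \<omega> ^ (q * k + j)))\<close> with \<open>k, j < q + 1\<close> is a
  symmetric conference matrix. Let \<open>s\<close> and \<open>t\<close> be the functions \<open>1\<^bsub>X 1\<^esub> - 1\<^bsub>X 3\<^esub>\<close> and
  \<open>1\<^bsub>X 2\<^esub> - 1\<^bsub>X 4\<^esub>\<close> at the powers \<open>\<omega> ^ j\<close>. Both change sign under \<open>\<omega> ^ (q + 1)\<close>, so summing over
  the cosets of the multiplicative group of the subfield turns the additive character sums into
  \<open>g\<close> times \<open>S s\<close> and \<open>S t\<close>, and the eigenmatrix says \<open>S s = - m s - (m - 1) t\<close> and
  \<open>S t = - (m + 1) s + m t\<close>. These two equations are exactly what is needed to make the doubling of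
  \<open>S\<close> to a Hadamard matrix of order \<open>2 (q + 1) = 4 m\<^sup>2\<close> regular by changing signs of rows and columns.
\<close>

section \<open>Regular Hadamard matrices from symmetric conference matrices\<close>

lemma bij_betw_add_lessThan:
  "bij_betw (\<lambda>k. k + N) {..<N} {N..<2 * N}" for N :: nat
  by (rule bij_betw_byWitness[where f' = "\<lambda>k. k - N"]) auto

lemma sum_lessThan_double:
  fixes h :: "nat \<Rightarrow> 'b::comm_monoid_add"
  shows "(\<Sum>j<2 * N. h j) = (\<Sum>j<N. h j + h (j + N))"
proof -
  have "(\<Sum>j<2 * N. h j) = (\<Sum>j<N. h j) + (\<Sum>j\<in>{N..<2 * N}. h j)"
    by (subst sum.union_disjoint[symmetric]) (auto intro!: sum.cong)
  also have "(\<Sum>j\<in>{N..<2 * N}. h j) = (\<Sum>j<N. h (j + N))"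
    by (rule sum.reindex_bij_betw[OF bij_betw_add_lessThan, symmetric])
  finally show ?thesis by (simp add: sum.distrib)
qed

lemma sum_conference_rows:
  fixes S :: "nat \<Rightarrow> nat \<Rightarrow> int"
  assumes "k < N" and "S k k = 0" and "\<And>j. j < N \<Longrightarrow> j \<noteq> k \<Longrightarrow> S k j \<in> {1, - 1}"
  shows "(\<Sum>j<N. S k j * S k j) = int N - 1"
proof -
  have "(\<Sum>j<N. S k j * S k j) = (\<Sum>j\<in>{..<N} - {k}. S k j * S k j)"
    using assms by (subst sum.remove[of _ k]) auto
  also have "\<dots> = (\<Sum>j\<in>{..<N} - {k}. 1)"
    using assms(3) by (intro sum.cong) fastforce+
  also have "\<dots> = int N - 1"
    using assms(1) by (simp add: of_nat_diff)
  finally show ?thesis .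
qed

lemma sum_delta_left:
  fixes h :: "nat \<Rightarrow> int"
  assumes "k < N"
  shows "(\<Sum>j<N. (if k = j then 1 else 0) * h j) = h k"
    and "(\<Sum>j<N. h j * (if k = j then 1 else 0)) = h k"
  using assms by (simp_all add: if_distrib[of "\<lambda>c. c * _"] if_distrib[of "\<lambda>c. _ * c"] cong: if_cong)

text \<open>
  The matrix \<open>[[S + I, S - I], [S - I, - S - I]]\<close> is the usual doubling of a symmetric conference
  matrix. Scaling its columns by \<open>(s - t, s + t)\<close> and its rows by \<open>(- (s + t), s - t)\<close> makes all
  row sums equal to \<open>2 m\<close>; the factor \<open>sgn m\<close> makes them positive.
\<close>

lemma regular_hadamard_matrix_from_conference:
  fixes S :: "nat \<Rightarrow> nat \<Rightarrow> int" and s t :: "nat \<Rightarrow> int" and m :: int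
  assumes "m \<noteq> 0"
    and diag: "\<And>k. k < N \<Longrightarrow> S k k = 0"
    and off: "\<And>k j. k < N \<Longrightarrow> j < N \<Longrightarrow> j \<noteq> k \<Longrightarrow> S k j \<in> {1, - 1}"
    and sym: "\<And>k j. k < N \<Longrightarrow> j < N \<Longrightarrow> S k j = S j k"
    and orth: "\<And>k l. k < N \<Longrightarrow> l < N \<Longrightarrow> k \<noteq> l \<Longrightarrow> (\<Sum>j<N. S k j * S l j) = 0"
    and st: "\<And>k. k < N \<Longrightarrow> (s k, t k) \<in> {(1, 0), (- 1, 0), (0, 1), (0, - 1)}"
    and Ss: "\<And>k. k < N \<Longrightarrow> (\<Sum>j<N. S k j * s j) = - m * s k - (m - 1) * t k"
    and St: "\<And>k. k < N \<Longrightarrow> (\<Sum>j<N. S k j * t j) = - (m + 1) * s k + m * t k"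
  shows "\<exists>H. regular_hadamard_matrix (2 * N) H"
proof -
  define \<delta> :: "nat \<Rightarrow> nat \<Rightarrow> int" where "\<delta> k j = (if k = j then 1 else 0)" for k j
  define B where "B i j = (if i < N then if j < N then S i j + \<delta> i j else S i (j - N) - \<delta> i (j - N)
      else if j < N then S (i - N) j - \<delta> (i - N) j else - S (i - N) (j - N) - \<delta> (i - N) (j - N))"
    for i j
  define v where "v j = (if j < N then s j - t j else s (j - N) + t (j - N))" for j
  define w where "w i = sgn m * (if i < N then - (s i + t i) else s (i - N) - t (i - N))" for i
  define h where "h i j = w i * B i j * v j" for i j
  have sgn: "sgn m \<in> {1, - 1}" using \<open>m \<noteq> 0\<close> by (auto simp: sgn_if)
  have less_double: "i < N \<or> (\<exists>k<N. i = k + N)" if "i < 2 * N" for i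
    using that by (cases "i < N") (auto intro!: exI[of _ "i - N"])
  have pm: "s k + t k \<in> {1, - 1}" "s k - t k \<in> {1, - 1}" if "k < N" for k
    using st[OF that] by auto
  have v: "v j \<in> {1, - 1}" if "j < 2 * N" for j
    using less_double[OF that] pm[of j] pm[of "j - N"] by (auto simp: v_def)
  have w: "w i \<in> {1, - 1}" if "i < 2 * N" for i
    using less_double[OF that] pm[of i] pm[of "i - N"] sgn by (auto simp: w_def)
  have pmS: "S k j + \<delta> k j \<in> {1, - 1}" "S k j - \<delta> k j \<in> {1, - 1}" "- S k j - \<delta> k j \<in> {1, - 1}"
    if "k < N" "j < N" for k j
    using off[OF that] diag[OF that(1)] by (cases "j = k"; auto simp: \<delta>_def)+
  have B: "B i j \<in> {1, - 1}" if "i < 2 * N" "j < 2 * N" for i j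
    using less_double[OF that(1)] less_double[OF that(2)]
      pmS[of i j] pmS[of i "j - N"] pmS[of "i - N" j] pmS[of "i - N" "j - N"]
    by (auto simp: B_def)
  have h: "h i j \<in> {1, - 1}" if "i < 2 * N" "j < 2 * N" for i j
    using v[OF that(2)] w[OF that(1)] B[OF that] by (auto simp: h_def)
  have SS: "(\<Sum>j<N. S k j * S l j) = (int N - 1) * \<delta> k l" if "k < N" "l < N" for k l
    using sum_conference_rows[of k N S] that orth[of k l] diag[of k] off[of k]
    by (cases "k = l") (auto simp: \<delta>_def)
  have \<delta>\<delta>: "(\<Sum>j<N. \<delta> k j * \<delta> l j) = \<delta> k l" if "k < N" "l < N" for k l
    unfolding \<delta>_def using that by (subst sum_delta_left(1)) auto
  have \<delta>S: "(\<Sum>j<N. \<delta> k j * S l j) = S l k" "(\<Sum>j<N. S l j * \<delta> k j) = S l k"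
    if "k < N" "l < N" for k l
    unfolding \<delta>_def using sum_delta_left[OF \<open>k < N\<close>] by simp_all
  have \<delta>z: "(\<Sum>j<N. \<delta> k j * z j) = z k" if "k < N" for k and z :: "nat \<Rightarrow> int"
    unfolding \<delta>_def using that by (simp add: sum_delta_left)
  have BB: "(\<Sum>j<2 * N. B i j * B i' j) = (if i = i' then 2 * int N else 0)"
    if "i < 2 * N" "i' < 2 * N" for i i'
  proof -
    define k where "k = (if i < N then i else i - N)"
    define l where "l = (if i' < N then i' else i' - N)"
    have kl: "k < N" "l < N" using that by (auto simp: k_def l_def)
    \<comment> \<open>Every inner product of two rows of \<open>B\<close> is a sum or difference of
      two such sums, with \<open>a\<close> and \<open>b\<close> the signs attached to the identity
      in the blocks.\<close>
    have exp: "(\<Sum>j<N. (S k j + a * \<delta> k j) * (S l j + b * \<delta> l j)) =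
        (int N - 1) * \<delta> k l + b * S k l + a * S l k + a * b * \<delta> k l" for a b
    proof -
      have "(\<Sum>j<N. (S k j + a * \<delta> k j) * (S l j + b * \<delta> l j)) =
        (\<Sum>j<N. S k j * S l j) + b * (\<Sum>j<N. S k j * \<delta> l j) + a * (\<Sum>j<N. \<delta> k j * S l j)
          + a * b * (\<Sum>j<N. \<delta> k j * \<delta> l j)"
        by (simp add: sum_distrib_left sum.distrib[symmetric] algebra_simps)
      then show ?thesis using SS[OF kl] \<delta>\<delta>[OF kl] \<delta>S(1)[OF kl] \<delta>S(2)[OF kl(2,1)] by simp
    qed
    \<comment> \<open>For two rows in the same half the terms linear in \<open>S\<close> cancel by
      their signs alone; for rows in different halves they cancel only because \<open>S\<close> is
      symmetric.\<close>
    have S_kl: "S k l = S l k" using sym kl by blast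
    have "(\<Sum>j<2 * N. B i j * B i' j) = (\<Sum>j<N. B i j * B i' j + B i (j + N) * B i' (j + N))"
      by (rule sum_lessThan_double)
    also have "\<dots> = (if i < N then if i' < N
        then (\<Sum>j<N. (S k j + 1 * \<delta> k j) * (S l j + 1 * \<delta> l j))
           + (\<Sum>j<N. (S k j + (-1) * \<delta> k j) * (S l j + (-1) * \<delta> l j))
        else (\<Sum>j<N. (S k j + 1 * \<delta> k j) * (S l j + (-1) * \<delta> l j))
           - (\<Sum>j<N. (S k j + (-1) * \<delta> k j) * (S l j + 1 * \<delta> l j))
        else if i' < N
        then (\<Sum>j<N. (S k j + (-1) * \<delta> k j) * (S l j + 1 * \<delta> l j))
           - (\<Sum>j<N. (S k j + 1 * \<delta> k j) * (S l j + (-1) * \<delta> l j))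
        else (\<Sum>j<N. (S k j + (-1) * \<delta> k j) * (S l j + (-1) * \<delta> l j))
           + (\<Sum>j<N. (S k j + 1 * \<delta> k j) * (S l j + 1 * \<delta> l j)))"
      by (auto simp: B_def k_def l_def sum.distrib[symmetric] sum_subtractf[symmetric] algebra_simps
          intro!: sum.cong)
    also have "\<dots> = (if i = i' then 2 * int N else 0)"
      unfolding exp using S_kl that by (auto simp: k_def l_def \<delta>_def algebra_simps)
    finally show ?thesis .
  qed
  have hh: "(\<Sum>j<2 * N. h i j * h i' j) = (if i = i' then int (2 * N) else 0)"
    if "i < 2 * N" "i' < 2 * N" for i i'
  proof -
    have "(\<Sum>j<2 * N. h i j * h i' j) = (\<Sum>j<2 * N. w i * w i' * (B i j * B i' j))"
      using v by (intro sum.cong refl) (fastforce simp: h_def)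
    also have "\<dots> = w i * w i' * (if i = i' then 2 * int N else 0)"
      by (simp only: sum_distrib_left[symmetric] BB[OF that])
    also have "\<dots> = (if i = i' then int (2 * N) else 0)"
      using w[OF that(1)] by auto
    finally show ?thesis .
  qed
  have Bv: "(\<Sum>j<2 * N. B i j * v j) = 2 * \<bar>m\<bar> * w i" if "i < 2 * N" for i
  proof -
    define k where "k = (if i < N then i else i - N)"
    have k: "k < N" using that by (auto simp: k_def)
    have "(\<Sum>j<2 * N. B i j * v j) = (\<Sum>j<N. B i j * v j + B i (j + N) * v (j + N))"
      by (rule sum_lessThan_double)
    also have "\<dots> = (if i < N then 2 * (\<Sum>j<N. S k j * s j) - 2 * (\<Sum>j<N. \<delta> k j * t j)
        else - 2 * (\<Sum>j<N. S k j * t j) - 2 * (\<Sum>j<N. \<delta> k j * s j))"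
      by (auto simp: B_def v_def k_def sum_distrib_left sum_negf[symmetric] sum_subtractf[symmetric]
          algebra_simps intro!: sum.cong)
    \<comment> \<open>The contribution of the identity blocks turns the coefficient
      \<open>m - 1\<close> of \<open>t k\<close> in \<open>Ss\<close>, and the coefficient
      \<open>m + 1\<close> of \<open>s k\<close> in \<open>St\<close>, into
      \<open>m\<close>.\<close>
    also have "\<dots> = 2 * m * (if i < N then - (s k + t k) else s k - t k)"
      using Ss[OF k] St[OF k] \<delta>z[OF k] by (simp add: algebra_simps)
    also have "\<dots> = 2 * \<bar>m\<bar> * w i"
      by (auto simp: w_def k_def abs_sgn)
    finally show ?thesis .
  qed
  have h1: "(\<Sum>j<2 * N. h i j) = 2 * \<bar>m\<bar>" if "i < 2 * N" for i
  proof -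
    have "(\<Sum>j<2 * N. h i j) = w i * (\<Sum>j<2 * N. B i j * v j)"
      by (simp add: h_def sum_distrib_left mult.assoc)
    then show ?thesis using Bv[OF that] w[OF that] by auto
  qed
  define H where "H = mat (2 * N) (2 * N) (\<lambda>(i, j). h i j)"
  have "H \<in> carrier_mat (2 * N) (2 * N)" by (simp add: H_def)
  moreover have "elements_mat H \<subseteq> {1, - 1}"
    using h by (fastforce simp: elements_mat_def H_def)
  moreover have "H * transpose_mat H = of_nat (2 * N) \<cdot>\<^sub>m 1\<^sub>m (2 * N)"
  proof (rule eq_matI)
    fix i j assume ij: "i < dim_row (of_nat (2 * N) \<cdot>\<^sub>m 1\<^sub>m (2 * N) :: int mat)"
      "j < dim_col (of_nat (2 * N) \<cdot>\<^sub>m 1\<^sub>m (2 * N) :: int mat)"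
    then have "(H * transpose_mat H) $$ (i, j) = (\<Sum>k<2 * N. h i k * h j k)"
      by (simp add: H_def scalar_prod_def atLeast0LessThan)
    then show "(H * transpose_mat H) $$ (i, j) = (of_nat (2 * N) \<cdot>\<^sub>m 1\<^sub>m (2 * N)) $$ (i, j)"
      using hh[of i j] ij by simp
  qed (simp_all add: H_def)
  moreover have "H *\<^sub>v Matrix.vec (2 * N) (\<lambda>_. 1) = (2 * \<bar>m\<bar>) \<cdot>\<^sub>v Matrix.vec (2 * N) (\<lambda>_. 1)"
    using h1 by (intro eq_vecI) (simp_all add: H_def scalar_prod_def atLeast0LessThan)
  ultimately show ?thesis
    using \<open>m \<noteq> 0\<close> unfolding regular_hadamard_matrix_def hadamard_matrix_def
    by (intro exI[of _ H] conjI exI[of _ "2 * \<bar>m\<bar>"]) auto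
qed

section \<open>The quadratic character, the cyclic group of the large field and its subfield\<close>

definition quad_char_int :: "nat \<Rightarrow> 'a::field \<Rightarrow> int" where
  "quad_char_int q x =
     (if x = 0 then 0 else if \<exists>y\<in>subfield_of_order q. x = y ^ 2 then 1 else - 1)"

text \<open>Character values become entries of an integer matrix, so they are kept in
  \<open>int\<close>; complex numbers enter only through the Gauss sum.\<close>

lemma quadratic_char_eq_of_int: "quadratic_char q x = of_int (quad_char_int q x)"
  by (simp add: quadratic_char_def quad_char_int_def)

lemma quad_char_int_0 [simp]: "quad_char_int q 0 = 0"
  by (simp add: quad_char_int_def)

lemma quad_char_int_nonzero: "x \<noteq> 0 \<Longrightarrow> quad_char_int q x \<in> {1, - 1}"
  by (simp add: quad_char_int_def)

locale quadratic_extension =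
  fixes \<omega> :: "'a::{field,finite}" and p f q :: nat
  assumes prime_p: "prime p" and f_pos: "f > 0" and q_def: "q = p ^ f" and odd_q: "odd q"
    and card_field: "CARD('a) = q\<^sup>2" and primitive: "primitive_element \<omega>"
begin

abbreviation K :: "'a set" where "K \<equiv> subfield_of_order q"

abbreviation \<eta> :: "'a \<Rightarrow> int" where "\<eta> \<equiv> quad_char_int q"

definition tr :: "'a \<Rightarrow> 'a" where "tr x = x + x ^ q"

definition M :: nat where "M = q\<^sup>2 - 1"

lemma q_gt_1: "q > 1"
  using prime_gt_1_nat[OF prime_p] f_pos unfolding q_def by (metis one_less_power)

lemma omega_nonzero [simp]: "\<omega> \<noteq> 0"
  using primitive by (simp add: primitive_element_def)

lemma nonzero_power:
  assumes "x \<noteq> 0"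
  obtains k :: nat where "x = \<omega> ^ k"
  using primitive assms by (auto simp: primitive_element_def)

lemma card_nonzero: "card (UNIV - {0 :: 'a}) = M"
  using card_field by (simp add: M_def card_Diff_singleton)

lemma group_order_pos: "M > 0"
  using one_less_power[OF q_gt_1, of 2] by (simp add: M_def)

text \<open>Reducing exponents modulo \<open>d\<close> shows that the powers of
  \<open>\<omega>\<close> with exponent below \<open>d\<close> already exhaust the \<open>M\<close>
  nonzero elements.\<close>

lemma group_order_le: "M \<le> d" if "d > 0" "\<omega> ^ d = 1"
proof -
  have "UNIV - {0} \<subseteq> (\<lambda>k. \<omega> ^ k) ` {..<d}"
  proof
    fix x :: 'a assume "x \<in> UNIV - {0}"
    then obtain k where k: "x = \<omega> ^ k" using nonzero_power by blast
    have "x = (\<omega> ^ d) ^ (k div d) * \<omega> ^ (k mod d)"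
      unfolding k power_mult[symmetric] power_add[symmetric] by simp
    then show "x \<in> (\<lambda>k. \<omega> ^ k) ` {..<d}" using that by auto
  qed
  then have "card (UNIV - {0 :: 'a}) \<le> card ((\<lambda>k. \<omega> ^ k) ` {..<d})"
    by (rule card_mono[rotated]) simp
  also have "\<dots> \<le> d" using card_image_le[of "{..<d}" "\<lambda>k. \<omega> ^ k"] by simp
  finally show ?thesis by (simp add: card_nonzero)
qed

text \<open>By pigeonhole two of the \<open>M + 1\<close> powers with exponent at most
  \<open>M\<close> agree. This gives \<open>\<omega> ^ (j - i) = 1\<close> with
  \<open>j - i \<le> M\<close>, and \<open>group_order_le\<close> forces equality.\<close>

lemma omega_power_order: "\<omega> ^ M = 1"
proof -
  have "\<not> inj_on (\<lambda>k. \<omega> ^ k) {..M}"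
  proof
    assume "inj_on (\<lambda>k. \<omega> ^ k) {..M}"
    then have "card {..M} \<le> card (UNIV - {0 :: 'a})"
      by (rule card_inj_on_le) auto
    then show False by (simp add: card_nonzero)
  qed
  then obtain i j where ij: "i < j" "j \<le> M" "\<omega> ^ i = \<omega> ^ j"
    using linorder_inj_onI[of "{..M}" "\<lambda>k. \<omega> ^ k"] by force
  then have "\<omega> ^ i * \<omega> ^ (j - i) = \<omega> ^ i * 1" by (subst power_add[symmetric]) simp
  then have "\<omega> ^ (j - i) = 1" by simp
  moreover from this have "M \<le> j - i" using group_order_le ij(1) by simp
  with ij have "j - i = M" by linarith
  ultimately show ?thesis by simp
qed

lemma omega_power_eq_1_iff: "\<omega> ^ k = 1 \<longleftrightarrow> M dvd k"
proof
  assume k: "\<omega> ^ k = 1"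
  have "\<omega> ^ k = (\<omega> ^ M) ^ (k div M) * \<omega> ^ (k mod M)"
    unfolding power_mult[symmetric] power_add[symmetric] by simp
  then have "\<omega> ^ (k mod M) = 1" using k omega_power_order by simp
  then have "\<not> k mod M > 0"
    using group_order_le[of "k mod M"] mod_less_divisor[OF group_order_pos, of k] by linarith
  then show "M dvd k" by (simp add: mod_eq_0_iff_dvd)
qed (auto simp: power_mult omega_power_order elim!: dvdE)

lemma omega_power_eq_iff: "\<omega> ^ i = \<omega> ^ j \<longleftrightarrow> int M dvd int i - int j"
proof -
  have *: "\<omega> ^ i = \<omega> ^ j \<longleftrightarrow> int M dvd int j - int i" if "i \<le> j" for i j
  proof -
    have "\<omega> ^ j = \<omega> ^ i * \<omega> ^ (j - i)"
      using that by (subst power_add[symmetric]) simp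
    then have "\<omega> ^ i = \<omega> ^ j \<longleftrightarrow> \<omega> ^ (j - i) = 1" by auto
    also have "\<dots> \<longleftrightarrow> int M dvd int (j - i)"
      unfolding omega_power_eq_1_iff by (rule int_dvd_int_iff[symmetric])
    finally show ?thesis using that by (simp add: of_nat_diff)
  qed
  show ?thesis
  proof (cases "i \<le> j")
    case True
    then show ?thesis using *[of i j] dvd_diff_commute by blast
  next
    case False
    then show ?thesis using *[of j i] by auto
  qed
qed

lemma order_factor: "M = (q + 1) * (q - 1)"
  using q_gt_1 unfolding M_def by (cases q) (simp_all add: power2_eq_square)

lemma power_q_squared: "x ^ (q\<^sup>2) = (x :: 'a)"
proof (cases "x = 0")
  case False
  then obtain k where k: "x = \<omega> ^ k" using nonzero_power by blast
  have "q\<^sup>2 = Suc M" using group_order_pos by (simp add: M_def)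
  then have "x ^ (q\<^sup>2) = x ^ M * x" by (metis power_Suc2)
  moreover have "x ^ M = 1"
    unfolding k by (simp add: omega_power_eq_1_iff flip: power_mult)
  ultimately show ?thesis by simp
qed (use q_gt_1 in simp)

lemma power_q_power_q [simp]: "((x :: 'a) ^ q) ^ q = x"
  using power_q_squared[of x] by (simp add: power2_eq_square power_mult)

lemma CHAR_eq: "CHAR('a) = p"
proof -
  have "prime CHAR('a)"
    using prime_CHAR_semidom[where ?'a = 'a] finite_imp_CHAR_pos[where ?'a = 'a] by simp
  moreover have "CHAR('a) dvd p ^ (f * 2)"
    using CHAR_dvd_CARD[where ?'a = 'a] card_field q_def by (simp add: power_mult)
  ultimately show ?thesis
    using prime_p prime_dvd_power primes_dvd_imp_eq by blast
qed

lemma frobenius_add: "(x + y :: 'a) ^ (p ^ n) = x ^ (p ^ n) + y ^ (p ^ n)"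
  using freshmans_dream'[where ?'a = 'a, of "p ^ n" n x y] CHAR_eq prime_p by simp

lemma power_q_add: "(x + y :: 'a) ^ q = x ^ q + y ^ q"
  unfolding q_def by (rule frobenius_add)

lemma in_K_iff: "x \<in> K \<longleftrightarrow> x ^ q = x"
  by (simp add: subfield_of_order_def)

lemma zero_in_K [simp]: "0 \<in> K"
  using q_gt_1 by (simp add: in_K_iff)

lemma K_mult: "x \<in> K \<Longrightarrow> y \<in> K \<Longrightarrow> x * y \<in> K"
  by (simp add: in_K_iff power_mult_distrib)

lemma K_inverse: "x \<in> K \<Longrightarrow> inverse x \<in> K"
  by (simp add: in_K_iff power_inverse)

text \<open>Being fixed by the \<open>q\<close>-th power means that \<open>M\<close> divides
  \<open>k * (q - 1)\<close>, and the factor \<open>q - 1\<close> of \<open>M\<close>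
  cancels.\<close>

lemma omega_power_in_K_iff: "\<omega> ^ k \<in> K \<longleftrightarrow> q + 1 dvd k"
proof -
  have "\<omega> ^ k \<in> K \<longleftrightarrow> \<omega> ^ (k * q) = \<omega> ^ k" by (simp add: in_K_iff power_mult)
  also have "\<dots> \<longleftrightarrow> int M dvd int (k * q) - int k" by (rule omega_power_eq_iff)
  also have "int (k * q) - int k = int (k * (q - 1))"
    using q_gt_1 by (simp add: of_nat_diff algebra_simps)
  also have "int M dvd int (k * (q - 1)) \<longleftrightarrow> (q + 1) * (q - 1) dvd k * (q - 1)"
    unfolding order_factor by (rule int_dvd_int_iff)
  also have "\<dots> \<longleftrightarrow> q + 1 dvd k" using q_gt_1 by (intro dvd_times_right_cancel_iff) simp
  finally show ?thesis .
qed

lemma K_nonzero: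
  assumes "x \<in> K - {0}"
  obtains i where "x = \<omega> ^ ((q + 1) * i)"
proof -
  obtain k where k: "x = \<omega> ^ k" using assms nonzero_power by blast
  then obtain i where "k = (q + 1) * i" using assms omega_power_in_K_iff by (auto elim!: dvdE)
  then show thesis using k that by blast
qed

text \<open>The nonzero elements of \<open>K\<close> form a cyclic group generated by
  \<open>\<omega> ^ (q + 1)\<close>. Its order \<open>q - 1\<close> is even, so the parity of the
  exponent is well defined and decides whether the element is a square.\<close>

lemma eta_omega_power: "\<eta> (\<omega> ^ ((q + 1) * i)) = (- 1) ^ i"
proof -
  have "(\<exists>y\<in>K. \<omega> ^ ((q + 1) * i) = y ^ 2) \<longleftrightarrow> even i"
  proof
    assume "\<exists>y\<in>K. \<omega> ^ ((q + 1) * i) = y ^ 2"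
    then obtain y where y: "y \<in> K" "\<omega> ^ ((q + 1) * i) = y ^ 2" by blast
    then have "y \<noteq> 0" by (intro notI) simp
    then obtain l where l: "y = \<omega> ^ ((q + 1) * l)" using y(1) K_nonzero[of y] by blast
    have "\<omega> ^ ((q + 1) * i) = \<omega> ^ ((q + 1) * l * 2)" using y(2) l by (simp only: power_mult)
    then have "int M dvd int ((q + 1) * i) - int ((q + 1) * l * 2)"
      by (simp only: omega_power_eq_iff)
    also have "int ((q + 1) * i) - int ((q + 1) * l * 2) = int (q + 1) * (int i - 2 * int l)"
      by (simp add: algebra_simps)
    finally have "int (q - 1) dvd int i - 2 * int l"
      unfolding order_factor of_nat_mult by (subst (asm) dvd_mult_cancel_left) simp
    moreover have "2 dvd int (q - 1)" using odd_q by simp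
    ultimately have "2 dvd int i - 2 * int l" by (rule dvd_trans[rotated])
    then show "even i" by simp
  next
    assume "even i"
    then obtain l where "i = 2 * l" by blast
    then have "\<omega> ^ ((q + 1) * i) = (\<omega> ^ ((q + 1) * l)) ^ 2"
      by (simp add: mult_ac flip: power_mult)
    moreover have "\<omega> ^ ((q + 1) * l) \<in> K" by (simp only: omega_power_in_K_iff dvd_triv_left)
    ultimately show "\<exists>y\<in>K. \<omega> ^ ((q + 1) * i) = y ^ 2" by blast
  qed
  then show ?thesis by (simp add: quad_char_int_def)
qed

lemma eta_mult: "\<eta> (x * y) = \<eta> x * \<eta> y" if "x \<in> K" "y \<in> K"
proof (cases "x = 0 \<or> y = 0")
  case False
  then have "x \<in> K - {0}" "y \<in> K - {0}" using that by auto
  then obtain i j where "x = \<omega> ^ ((q + 1) * i)" "y = \<omega> ^ ((q + 1) * j)"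
    by (elim K_nonzero) blast
  moreover from this have "x * y = \<omega> ^ ((q + 1) * (i + j))"
    by (simp only: power_add[symmetric] distrib_left)
  ultimately show ?thesis by (simp only: eta_omega_power power_add)
qed auto

lemma eta_square: "\<eta> x * \<eta> x = 1" if "x \<noteq> 0"
  using quad_char_int_nonzero[OF that, of q] by auto

lemma bij_betw_K_mult: "bij_betw ((*) c) (K - {0}) (K - {0})" if "c \<in> K - {0}"
  by (rule bij_betw_byWitness[where f' = "(*) (inverse c)"])
    (use that K_mult K_inverse in \<open>auto simp: mult.assoc[symmetric]\<close>)

text \<open>Multiplication by the non-square \<open>\<omega> ^ (q + 1)\<close> permutes the nonzero
  elements of \<open>K\<close> and flips every sign.\<close>

lemma sum_eta: "(\<Sum>c\<in>K - {0}. \<eta> c) = 0"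
proof -
  define z where "z = \<omega> ^ (q + 1)"
  have z: "z \<in> K - {0}" using omega_power_in_K_iff[of "q + 1"] by (simp add: z_def)
  have \<eta>z: "\<eta> z = - 1" using eta_omega_power[of 1] by (simp add: z_def)
  have "(\<Sum>c\<in>K - {0}. \<eta> c) = (\<Sum>c\<in>K - {0}. \<eta> (z * c))"
    by (rule sum.reindex_bij_betw[OF bij_betw_K_mult[OF z], symmetric])
  also have "\<dots> = (\<Sum>c\<in>K - {0}. - \<eta> c)"
    using z \<eta>z by (intro sum.cong refl) (simp add: eta_mult)
  finally show ?thesis by (simp add: sum_negf)
qed

text \<open>The powers \<open>\<omega> ^ j\<close> with \<open>j < q + 1\<close> represent the
  cosets of \<open>K - {0}\<close> in the multiplicative group. This turns sums over the field into
  sums over the \<open>q + 1\<close> indices of the conference matrix.\<close>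

lemma sum_nonzero_cosets:
  "(\<Sum>x\<in>UNIV - {0}. h x) = (\<Sum>j<q + 1. \<Sum>c\<in>K - {0}. h (c * \<omega> ^ j))"
  for h :: "'a \<Rightarrow> 'b::comm_monoid_add"
proof -
  have "bij_betw (\<lambda>(j, c). c * \<omega> ^ j) ({..<q + 1} \<times> (K - {0})) (UNIV - {0})"
  proof (intro bij_betwI')
    fix a b assume ab: "a \<in> {..<q + 1} \<times> (K - {0})" "b \<in> {..<q + 1} \<times> (K - {0})"
    obtain j c j' c' where [simp]: "a = (j, c)" "b = (j', c')" by force
    have j: "j < q + 1" "j' < q + 1" "c \<in> K - {0}" "c' \<in> K - {0}" using ab by auto
    obtain i where i: "c = \<omega> ^ ((q + 1) * i)" using K_nonzero j(3) by blast
    obtain i' where i': "c' = \<omega> ^ ((q + 1) * i')" using K_nonzero j(4) by blast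
    show "((\<lambda>(j, c). c * \<omega> ^ j) a = (\<lambda>(j, c). c * \<omega> ^ j) b) \<longleftrightarrow> a = b"
    proof
      assume "(\<lambda>(j, c). c * \<omega> ^ j) a = (\<lambda>(j, c). c * \<omega> ^ j) b"
      then have eq: "c * \<omega> ^ j = c' * \<omega> ^ j'" by simp
      then have "\<omega> ^ ((q + 1) * i + j) = \<omega> ^ ((q + 1) * i' + j')"
        unfolding i i' power_add .
      then have "int M dvd int ((q + 1) * i + j) - int ((q + 1) * i' + j')"
        by (simp only: omega_power_eq_iff)
      \<comment> \<open>The factor \<open>q + 1\<close> of \<open>M\<close> is enough: modulo it the
        parts of the exponents coming from \<open>c\<close> and \<open>c'\<close> drop out.\<close>
      then have "int (q + 1) dvd int ((q + 1) * i + j) - int ((q + 1) * i' + j')"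
        unfolding order_factor of_nat_mult by (rule dvd_mult_left)
      then have "int ((q + 1) * i + j) mod int (q + 1) = int ((q + 1) * i' + j') mod int (q + 1)"
        by (simp only: mod_eq_dvd_iff)
      then have "((q + 1) * i + j) mod (q + 1) = ((q + 1) * i' + j') mod (q + 1)"
        by (simp only: of_nat_mod[symmetric] of_nat_eq_iff)
      then have "j = j'" using j(1,2) by (simp only: mod_mult_self4 mod_less)
      then show "a = b" using eq by simp
    qed simp
  next
    fix x :: 'a assume "x \<in> UNIV - {0}"
    then obtain k where k: "x = \<omega> ^ k" using nonzero_power by blast
    have "x = \<omega> ^ ((q + 1) * (k div (q + 1))) * \<omega> ^ (k mod (q + 1))"
      unfolding k power_add[symmetric] by (simp only: mult_div_mod_eq)
    moreover have "\<omega> ^ ((q + 1) * (k div (q + 1))) \<in> K - {0}"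
      using omega_power_in_K_iff[of "(q + 1) * (k div (q + 1))"]
      by (simp only: dvd_triv_left Diff_iff singleton_iff power_not_zero omega_nonzero simp_thms)
    moreover have "k mod (q + 1) < q + 1" by (rule mod_less_divisor) simp
    ultimately show "\<exists>a\<in>{..<q + 1} \<times> (K - {0}). x = (\<lambda>(j, c). c * \<omega> ^ j) a"
      by (intro bexI[of _ "(k mod (q + 1), \<omega> ^ ((q + 1) * (k div (q + 1))))"]) auto
  qed auto
  from sum.reindex_bij_betw[OF this, of h] show ?thesis
    by (simp add: sum.cartesian_product split_def)
qed

text \<open>Counting the nonzero elements coset by coset shows that \<open>M\<close> is
  \<open>q + 1\<close> times this cardinality.\<close>

lemma card_K_nonzero: "card (K - {0}) = q - 1"
proof -
  have "card (UNIV - {0 :: 'a}) = (q + 1) * card (K - {0})"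
    using sum_nonzero_cosets[of "\<lambda>_. 1 :: nat"] by simp
  then have "(q + 1) * (q - 1) = (q + 1) * card (K - {0})"
    unfolding card_nonzero order_factor .
  then show ?thesis by (subst (asm) mult_cancel1) simp
qed

lemma card_K: "card K = q"
  using card_Suc_Diff1[of K 0] card_K_nonzero q_gt_1 by simp

section \<open>The relative trace, additive characters and Gauss sums\<close>

lemma tr_0 [simp]: "tr 0 = 0"
  using q_gt_1 by (simp add: tr_def power_0_left)

lemma tr_in_K: "tr x \<in> K"
  by (simp add: tr_def in_K_iff power_q_add add.commute)

lemma tr_power_q: "tr (x ^ q) = tr x"
  by (simp add: tr_def add.commute)

lemma tr_K_mult: "c \<in> K \<Longrightarrow> tr (c * x) = c * tr x"
  by (simp add: tr_def in_K_iff power_mult_distrib distrib_left)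

lemma tr_add: "tr (x + y) = tr x + tr y"
  by (simp add: tr_def power_q_add)

lemma power_q_minus: "(- x :: 'a) ^ q = - (x ^ q)"
  using odd_q by (rule power_minus_odd)

lemma tr_minus: "tr (- x) = - tr x"
  by (simp add: tr_def power_q_minus)

lemma tr_diff: "tr (x - y) = tr x - tr y"
  using tr_add[of x "- y"] by (simp add: tr_minus)

text \<open>Transitivity of the trace: the Frobenius exponents below \<open>2 * f\<close> split at
  \<open>f\<close>, and since \<open>q = p ^ f\<close> the upper half is the same sum for
  \<open>x ^ q\<close>.\<close>

lemma abs_trace_tower: "abs_trace p (2 * f) x = abs_trace p f (tr x)" for x :: 'a
proof -
  have "abs_trace p (2 * f) x = (\<Sum>i<f. x ^ (p ^ i)) + (\<Sum>i\<in>{f..<2 * f}. x ^ (p ^ i))"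
    unfolding abs_trace_def by (subst sum.union_disjoint[symmetric]) (auto intro!: sum.cong)
  also have "(\<Sum>i\<in>{f..<2 * f}. x ^ (p ^ i)) = (\<Sum>i<f. x ^ (p ^ (i + f)))"
    by (rule sum.reindex_bij_witness[of _ "\<lambda>i. i + f" "\<lambda>i. i - f"]) auto
  also have "\<dots> = (\<Sum>i<f. (x ^ q) ^ (p ^ i))"
    by (simp add: q_def power_add mult.commute flip: power_mult)
  finally show ?thesis
    by (simp add: abs_trace_def tr_def frobenius_add sum.distrib)
qed

lemma add_char_tower: "add_char p (2 * f) x = add_char p f (tr x)" for x :: 'a
  by (simp add: add_char_def abs_trace_tower)

lemma gauss_sum_quadratic:
  "gauss_sum p f (quadratic_char q :: 'a \<Rightarrow> complex) = (\<Sum>c\<in>K - {0}. of_int (\<eta> c) * add_char p f c)"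
  unfolding gauss_sum_def q_def[symmetric] quadratic_char_eq_of_int ..

text \<open>On the coset of \<open>y\<close> the additive character depends only on
  \<open>c * tr y\<close>. Substituting \<open>tr y * c\<close> for \<open>c\<close> in the Gauss
  sum pulls out \<open>\<eta> (tr y)\<close>.\<close>

lemma sum_eta_add_char:
  "(\<Sum>c\<in>K - {0}. of_int (\<eta> c) * add_char p (2 * f) (c * y)) =
    of_int (\<eta> (tr y)) * gauss_sum p f (quadratic_char q :: 'a \<Rightarrow> complex)"
proof -
  have lhs: "(\<Sum>c\<in>K - {0}. of_int (\<eta> c) * add_char p (2 * f) (c * y)) =
    (\<Sum>c\<in>K - {0}. of_int (\<eta> c) * add_char p f (tr y * c))"
  proof (intro sum.cong refl)
    fix c assume "c \<in> K - {0}"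
    then have "tr (c * y) = tr y * c" using tr_K_mult[of c y] by (simp add: mult.commute)
    then show "of_int (\<eta> c) * add_char p (2 * f) (c * y) = of_int (\<eta> c) * add_char p f (tr y * c)"
      by (simp only: add_char_tower)
  qed
  show ?thesis
  proof (cases "tr y = 0")
    \<comment> \<open>The additive character is now constant on the coset, so the left side vanishes
      by \<open>sum_eta\<close>; the right side vanishes through the convention
      \<open>\<eta> 0 = 0\<close>.\<close>
    case True
    have "(\<Sum>c\<in>K - {0}. of_int (\<eta> c) * add_char p f (0 :: 'a)) =
      of_int (\<Sum>c\<in>K - {0}. \<eta> c) * add_char p f (0 :: 'a)"
      by (simp add: sum_distrib_right)
    then show ?thesis using lhs True sum_eta by simp
  next
    case False
    then have t: "tr y \<in> K - {0}" using tr_in_K by blast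
    have "of_int (\<eta> (tr y)) * gauss_sum p f (quadratic_char q :: 'a \<Rightarrow> complex) =
      of_int (\<eta> (tr y)) * (\<Sum>c\<in>K - {0}. of_int (\<eta> (tr y * c)) * add_char p f (tr y * c))"
      unfolding gauss_sum_quadratic
      by (subst sum.reindex_bij_betw[OF bij_betw_K_mult[OF t], symmetric]) (rule refl)
    also have "\<dots> = (\<Sum>c\<in>K - {0}. of_int (\<eta> (tr y) * \<eta> (tr y) * \<eta> c) * add_char p f (tr y * c))"
      using t by (auto simp: sum_distrib_left eta_mult mult_ac intro!: sum.cong)
    also have "\<dots> = (\<Sum>c\<in>K - {0}. of_int (\<eta> c) * add_char p f (tr y * c))"
      by (simp add: eta_square[OF False])
    finally show ?thesis using lhs by simp
  qed
qed

text \<open>Each coset contributes an integer multiple of one and the same Gauss sum. Complex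
  character sums of such functions thus become integer equations once that Gauss sum is
  cancelled.\<close>

lemma sum_odd_add_char:
  fixes \<sigma> :: "'a \<Rightarrow> int"
  assumes "\<And>c x. c \<in> K - {0} \<Longrightarrow> \<sigma> (c * x) = \<eta> c * \<sigma> x"
  shows "(\<Sum>x\<in>UNIV - {0}. of_int (\<sigma> x) * add_char p (2 * f) (a * x)) =
    of_int (\<Sum>j<q + 1. \<eta> (tr (a * \<omega> ^ j)) * \<sigma> (\<omega> ^ j)) *
      gauss_sum p f (quadratic_char q :: 'a \<Rightarrow> complex)"
proof -
  have "(\<Sum>x\<in>UNIV - {0}. of_int (\<sigma> x) * add_char p (2 * f) (a * x)) =
    (\<Sum>j<q + 1. \<Sum>c\<in>K - {0}. of_int (\<sigma> (\<omega> ^ j)) *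
      (of_int (\<eta> c) * add_char p (2 * f) (c * (a * \<omega> ^ j))))"
    unfolding sum_nonzero_cosets by (intro sum.cong refl) (simp add: assms mult_ac)
  also have "\<dots> = (\<Sum>j<q + 1. of_int (\<sigma> (\<omega> ^ j)) * (of_int (\<eta> (tr (a * \<omega> ^ j))) *
      gauss_sum p f (quadratic_char q :: 'a \<Rightarrow> complex)))"
    by (simp only: sum_distrib_left[symmetric] sum_eta_add_char)
  also have "\<dots> = of_int (\<Sum>j<q + 1. \<eta> (tr (a * \<omega> ^ j)) * \<sigma> (\<omega> ^ j)) *
      gauss_sum p f (quadratic_char q :: 'a \<Rightarrow> complex)"
    unfolding of_int_sum sum_distrib_right by (intro sum.cong refl) simp
  finally show ?thesis .
qed

section \<open>The conference matrix of trace values\<close>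

lemma tr_zero_quotient:
  assumes "tr x = 0" and "tr y = 0"
  shows "x / y \<in> K"
proof -
  \<comment> \<open>Elements of trace zero are negated by the \<open>q\<close>-th power, so the two
    signs cancel in a quotient.\<close>
  have "x ^ q = - x" "y ^ q = - y" using assms by (simp_all add: tr_def eq_neg_iff_add_eq_0 add.commute)
  then show ?thesis by (simp add: in_K_iff power_divide)
qed

text \<open>
  For \<open>a / b\<close> outside the subfield, \<open>x \<mapsto> (tr (a x), tr (b x))\<close> is a bijection onto pairs, so the
  sum over the whole field factors into two vanishing sums of the quadratic character.
\<close>

lemma sum_eta_tr_orthogonal:
  assumes "b \<noteq> 0" and "a / b \<notin> K"
  shows "(\<Sum>j<q + 1. \<eta> (tr (a * \<omega> ^ j)) * \<eta> (tr (b * \<omega> ^ j))) = 0"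
proof -
  have inj: "inj (\<lambda>x. (tr (a * x), tr (b * x)))"
  proof (rule injI)
    fix x y assume "(tr (a * x), tr (b * x)) = (tr (a * y), tr (b * y))"
    then have "tr (a * (x - y)) = 0" "tr (b * (x - y)) = 0"
      by (simp_all add: right_diff_distrib tr_diff)
    then have "a * (x - y) / (b * (x - y)) \<in> K" by (rule tr_zero_quotient)
    then show "x = y" using assms by (cases "x = y") auto
  qed
  have "(\<lambda>x. (tr (a * x), tr (b * x))) ` UNIV = K \<times> K"
  proof (rule card_subset_eq)
    show "card ((\<lambda>x. (tr (a * x), tr (b * x))) ` UNIV) = card (K \<times> K)"
      by (simp add: card_image[OF inj] card_field card_cartesian_product card_K power2_eq_square)
  qed (auto simp: tr_in_K)
  with inj have bij: "bij_betw (\<lambda>x. (tr (a * x), tr (b * x))) UNIV (K \<times> K)"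
    by (simp add: bij_betw_def)
  have "(\<Sum>c\<in>K. \<eta> c) = 0"
    using sum_eta by (simp add: sum_diff1)
  then have "0 = (\<Sum>u\<in>K. \<eta> u) * (\<Sum>v\<in>K. \<eta> v)" by simp
  also have "\<dots> = (\<Sum>(u, v)\<in>K \<times> K. \<eta> u * \<eta> v)"
    by (simp add: sum_product sum.cartesian_product)
  also have "\<dots> = (\<Sum>x\<in>UNIV. \<eta> (tr (a * x)) * \<eta> (tr (b * x)))"
    using sum.reindex_bij_betw[OF bij, of "\<lambda>(u, v). \<eta> u * \<eta> v"] by simp
  also have "\<dots> = (\<Sum>x\<in>UNIV - {0}. \<eta> (tr (a * x)) * \<eta> (tr (b * x)))"
    by (subst sum.remove[of _ 0]) simp_all
  also have "\<dots> = (\<Sum>j<q + 1. \<Sum>c\<in>K - {0}. \<eta> (tr (a * \<omega> ^ j)) * \<eta> (tr (b * \<omega> ^ j)))"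
    unfolding sum_nonzero_cosets
  proof (intro sum.cong refl)
    fix j c assume c: "c \<in> K - {0}"
    \<comment> \<open>Both factors pick up the same sign \<open>\<eta> c\<close>, so the product is
      constant on each coset.\<close>
    have "\<eta> (tr (d * (c * \<omega> ^ j))) = \<eta> c * \<eta> (tr (d * \<omega> ^ j))" for d
      using c tr_K_mult[of c "d * \<omega> ^ j"] by (simp add: mult.left_commute eta_mult tr_in_K)
    then show "\<eta> (tr (a * (c * \<omega> ^ j))) * \<eta> (tr (b * (c * \<omega> ^ j))) =
        \<eta> (tr (a * \<omega> ^ j)) * \<eta> (tr (b * \<omega> ^ j))"
      using eta_square[of c] c by (simp add: mult_ac)
  qed
  also have "\<dots> = int (q - 1) * (\<Sum>j<q + 1. \<eta> (tr (a * \<omega> ^ j)) * \<eta> (tr (b * \<omega> ^ j)))"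
    by (simp only: sum_constant card_K_nonzero sum_distrib_left)
  finally show ?thesis using q_gt_1 by simp
qed

text \<open>The exponent is half of \<open>M\<close>, so this is a square root of 1 other than 1. It
  serves both to evaluate \<open>\<eta> (- 1)\<close> and to find elements with
  \<open>\<beta> ^ q = - \<beta>\<close>.\<close>

lemma omega_power_half: "\<omega> ^ ((q + 1) * ((q - 1) div 2)) = - 1"
proof -
  let ?x = "\<omega> ^ ((q + 1) * ((q - 1) div 2))"
  have h: "(q - 1) div 2 * 2 = q - 1" using odd_q by simp
  have "?x ^ 2 = \<omega> ^ M"
    unfolding power_mult[symmetric] mult.assoc h order_factor ..
  then have "?x ^ 2 = 1" by (simp add: omega_power_order)
  moreover have "?x \<noteq> 1"
  proof
    assume "?x = 1"
    then have "(q + 1) * (q - 1) dvd (q + 1) * ((q - 1) div 2)"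
      by (simp only: omega_power_eq_1_iff order_factor)
    then have "q - 1 dvd (q - 1) div 2" by (subst (asm) dvd_times_left_cancel_iff) simp_all
    moreover have "(q - 1) div 2 > 0" "(q - 1) div 2 < q - 1" using h q_gt_1 by linarith+
    ultimately show False using dvd_imp_le by (meson not_le)
  qed
  ultimately show ?thesis by (simp add: power2_eq_1_iff)
qed

text \<open>For \<open>q mod 4 = 1\<close> the exponent \<open>(q - 1) div 2\<close> of the
  generator \<open>\<omega> ^ (q + 1)\<close> in \<open>- 1\<close> is even. This is the source of
  the symmetry of the conference matrix.\<close>

lemma eta_minus:
  assumes "q mod 4 = 1" and "x \<in> K"
  shows "\<eta> (- x) = \<eta> x"
proof -
  have "- 1 \<in> K"
    unfolding omega_power_half[symmetric] by (simp only: omega_power_in_K_iff dvd_triv_left)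
  moreover have "even ((q - 1) div 2)" using assms(1) by presburger
  then have "\<eta> (- 1) = 1"
    unfolding omega_power_half[symmetric] eta_omega_power by simp
  ultimately show ?thesis using eta_mult[of "- 1" x] assms(2) by simp
qed

text \<open>Dividing by \<open>\<beta>\<close>, also of trace zero, puts
  \<open>\<omega> ^ (k * q + j)\<close> into \<open>K\<close>. Then \<open>q + 1\<close> divides
  \<open>k * q + j\<close>, which is congruent to \<open>j - k\<close>. Hence off-diagonal entries
  of the conference matrix are nonzero.\<close>

lemma tr_omega_power_eq_0:
  assumes "tr \<beta> = 0" "\<beta> \<noteq> 0" "tr (\<beta> * (\<omega> ^ k) ^ q * \<omega> ^ j) = 0" "k < q + 1" "j < q + 1"
  shows "j = k"
proof -
  have "\<beta> * (\<omega> ^ k) ^ q * \<omega> ^ j / \<beta> \<in> K" using tr_zero_quotient assms(1,3) by blast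
  then have "\<omega> ^ (k * q + j) \<in> K" using assms(2) by (simp add: power_add power_mult)
  then have "int (q + 1) dvd int (k * q + j)" by (simp only: omega_power_in_K_iff int_dvd_int_iff)
  then have "int (q + 1) dvd int (q + 1) * int k - int (k * q + j)" by (intro dvd_diff) auto
  also have "int (q + 1) * int k - int (k * q + j) = int k - int j" by (simp add: algebra_simps)
  finally have "int k mod int (q + 1) = int j mod int (q + 1)" by (simp only: mod_eq_dvd_iff)
  then show ?thesis using assms(4,5) by simp
qed

text \<open>The twist \<open>x ^ q\<close> in the row argument makes the diagonal involve norms and
  lets the \<open>q\<close>-th power exchange rows and columns. Evaluated at powers of
  \<open>\<omega>\<close>, \<open>eigen\<close> and \<open>eigen'\<close> become the two row
  equations of the combinatorial lemma.\<close>

lemma regular_hadamard_matrix_from_odd_functions: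
  fixes \<sigma> \<sigma>' :: "'a \<Rightarrow> int" and m :: int
  assumes q4: "q mod 4 = 1" and "m \<noteq> 0" and \<beta>: "\<beta> \<noteq> 0" "\<beta> ^ q = - \<beta>"
    and signs: "\<And>x. x \<noteq> 0 \<Longrightarrow> (\<sigma> x, \<sigma>' x) \<in> {(1, 0), (- 1, 0), (0, 1), (0, - 1)}"
    and eigen: "\<And>x. x \<noteq> 0 \<Longrightarrow>
      (\<Sum>j<q + 1. \<eta> (tr (\<beta> * x ^ q * \<omega> ^ j)) * \<sigma> (\<omega> ^ j)) = - m * \<sigma> x - (m - 1) * \<sigma>' x"
    and eigen': "\<And>x. x \<noteq> 0 \<Longrightarrow>
      (\<Sum>j<q + 1. \<eta> (tr (\<beta> * x ^ q * \<omega> ^ j)) * \<sigma>' (\<omega> ^ j)) = - (m + 1) * \<sigma> x + m * \<sigma>' x"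
  shows "\<exists>H. regular_hadamard_matrix (2 * (q + 1)) H"
proof -
  define S where "S k j = \<eta> (tr (\<beta> * (\<omega> ^ k) ^ q * \<omega> ^ j))" for k j
  have tr_\<beta>: "tr \<beta> = 0" using \<beta> by (simp add: tr_def)
  \<comment> \<open>The norm \<open>\<omega> ^ ((q + 1) * k)\<close> of \<open>\<omega> ^ k\<close>
    lies in \<open>K\<close>, so it can be pulled out of the trace, leaving
    \<open>tr \<beta> = 0\<close>.\<close>
  have tr_diag: "tr (\<beta> * (\<omega> ^ k) ^ q * \<omega> ^ k) = 0" for k
  proof -
    have "\<omega> ^ ((q + 1) * k) \<in> K" by (simp only: omega_power_in_K_iff dvd_triv_left)
    then have "tr (\<omega> ^ ((q + 1) * k) * \<beta>) = 0" using tr_K_mult tr_\<beta> by simp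
    moreover have "\<omega> ^ ((q + 1) * k) * \<beta> = \<beta> * (\<omega> ^ k) ^ q * \<omega> ^ k"
      by (simp add: power_add mult_ac flip: power_mult)
    ultimately show ?thesis by (simp only:)
  qed
  show ?thesis
  proof (rule regular_hadamard_matrix_from_conference[of m "q + 1" S "\<lambda>j. \<sigma> (\<omega> ^ j)" "\<lambda>j. \<sigma>' (\<omega> ^ j)"])
    fix k
    show "S k k = 0" by (simp only: S_def tr_diag quad_char_int_0)
  next
    fix k j assume "k < q + 1" "j < q + 1" "j \<noteq> k"
    then show "S k j \<in> {1, - 1}"
      unfolding S_def by (intro quad_char_int_nonzero notI) (use tr_omega_power_eq_0 tr_\<beta> \<beta>(1) in blast)
  next
    fix k j
    \<comment> \<open>The \<open>q\<close>-th power swaps the indices at the cost of a sign, which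
      \<open>\<eta>\<close> does not see.\<close>
    have "(\<beta> * (\<omega> ^ k) ^ q * \<omega> ^ j) ^ q = - (\<beta> * (\<omega> ^ j) ^ q * \<omega> ^ k)"
      by (simp only: power_mult_distrib power_q_power_q \<beta>(2)) (simp add: mult_ac)
    then have "tr (\<beta> * (\<omega> ^ k) ^ q * \<omega> ^ j) = - tr (\<beta> * (\<omega> ^ j) ^ q * \<omega> ^ k)"
      using tr_power_q[of "\<beta> * (\<omega> ^ k) ^ q * \<omega> ^ j"] by (simp only: tr_minus)
    then show "S k j = S j k" unfolding S_def by (simp add: eta_minus[OF q4 tr_in_K])
  next
    fix k l assume kl: "k < q + 1" "l < q + 1" "k \<noteq> l"
    let ?a = "\<beta> * (\<omega> ^ k) ^ q" and ?b = "\<beta> * (\<omega> ^ l) ^ q"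
    have "?a / ?b \<notin> K"
    proof
      assume "?a / ?b \<in> K"
      then have "(\<omega> ^ k / \<omega> ^ l) ^ q \<in> K" using \<beta>(1) by (simp add: power_divide)
      then have "\<omega> ^ k / \<omega> ^ l \<in> K" by (simp add: in_K_iff)
      \<comment> \<open>Scaling the diagonal argument for \<open>l\<close> by this element of
        \<open>K\<close> would produce a zero at the off-diagonal position
        \<open>(l, k)\<close>.\<close>
      then have "tr (\<omega> ^ k / \<omega> ^ l * (\<beta> * (\<omega> ^ l) ^ q * \<omega> ^ l)) = \<omega> ^ k / \<omega> ^ l * 0"
        by (simp only: tr_K_mult tr_diag)
      then have "tr (\<beta> * (\<omega> ^ l) ^ q * \<omega> ^ k) = 0" by (simp add: mult_ac)
      then show False using tr_omega_power_eq_0 tr_\<beta> \<beta>(1) kl by blast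
    qed
    then show "(\<Sum>j<q + 1. S k j * S l j) = 0"
      unfolding S_def using \<beta>(1) by (intro sum_eta_tr_orthogonal) auto
  next
    fix k
    show "(\<sigma> (\<omega> ^ k), \<sigma>' (\<omega> ^ k)) \<in> {(1, 0), (- 1, 0), (0, 1), (0, - 1)}"
      by (rule signs) simp
    show "(\<Sum>j<q + 1. S k j * \<sigma> (\<omega> ^ j)) = - m * \<sigma> (\<omega> ^ k) - (m - 1) * \<sigma>' (\<omega> ^ k)"
      unfolding S_def by (rule eigen) simp
    show "(\<Sum>j<q + 1. S k j * \<sigma>' (\<omega> ^ j)) = - (m + 1) * \<sigma> (\<omega> ^ k) + m * \<sigma>' (\<omega> ^ k)"
      unfolding S_def by (rule eigen') simp
  qed fact
qed

end

section \<open>Sign functions of the partition and the use of the eigenmatrix\<close>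

lemma cyclotomic_class_mult_iff:
  assumes "\<omega> \<noteq> 0"
  shows "\<omega> powi e * x \<in> cyclotomic_class \<omega> e i \<longleftrightarrow> x \<in> cyclotomic_class \<omega> e i"
proof
  assume "\<omega> powi e * x \<in> cyclotomic_class \<omega> e i"
  then obtain k where k: "\<omega> powi e * x = \<omega> powi i * (\<omega> powi e) powi k"
    by (auto simp: cyclotomic_class_def)
  have "(\<omega> powi e) powi k = \<omega> powi e * (\<omega> powi e) powi (k - 1)"
    using assms by (simp add: power_int_diff)
  with k have "\<omega> powi e * x = \<omega> powi e * (\<omega> powi i * (\<omega> powi e) powi (k - 1))"
    by (simp only: mult_ac)
  then have "x = \<omega> powi i * (\<omega> powi e) powi (k - 1)" using assms by simp
  then show "x \<in> cyclotomic_class \<omega> e i" by (auto simp: cyclotomic_class_def)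
next
  assume "x \<in> cyclotomic_class \<omega> e i"
  then obtain k where "x = \<omega> powi i * (\<omega> powi e) powi k"
    by (auto simp: cyclotomic_class_def)
  then have "\<omega> powi e * x = \<omega> powi i * (\<omega> powi e) powi (k + 1)"
    using assms by (simp add: power_int_add mult_ac)
  then show "\<omega> powi e * x \<in> cyclotomic_class \<omega> e i" by (auto simp: cyclotomic_class_def)
qed

definition signed_indicator :: "'a set \<Rightarrow> 'a set \<Rightarrow> 'a \<Rightarrow> int" where
  "signed_indicator A B x = (if x \<in> A then 1 else 0) - (if x \<in> B then 1 else 0)"

lemma sum_signed_indicator:
  fixes h :: "'a::finite \<Rightarrow> 'b::comm_ring_1"
  assumes "A \<subseteq> U" "B \<subseteq> U"
  shows "(\<Sum>x\<in>U. of_int (signed_indicator A B x) * h x) = (\<Sum>x\<in>A. h x) - (\<Sum>x\<in>B. h x)"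
proof -
  have "(\<Sum>x\<in>U. of_int (signed_indicator A B x) * h x) =
      (\<Sum>x\<in>U. if x \<in> A then h x else 0) - (\<Sum>x\<in>U. if x \<in> B then h x else 0)"
    by (auto simp: signed_indicator_def sum_subtractf[symmetric] intro!: sum.cong)
  then show ?thesis using assms by (simp add: sum.If_cases Int_absorb1 Int_def[symmetric])
qed

text \<open>Multiplication by \<open>\<omega> ^ (q + 1)\<close> carries \<open>B\<close> to
  \<open>A\<close>, and back again because its square preserves \<open>B\<close>. So it negates the
  function, in agreement with its value -1 under \<open>\<eta>\<close>; as it generates
  \<open>K - {0}\<close>, induction on the exponent finishes.\<close>

lemma (in quadratic_extension) signed_indicator_odd:
  assumes shift: "A = (\<lambda>x. \<omega> ^ (q + 1) * x) ` B"
    and closed: "\<And>x. \<omega> ^ (2 * (q + 1)) * x \<in> B \<longleftrightarrow> x \<in> B"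
    and "c \<in> K - {0}"
  shows "signed_indicator A B (c * x) = \<eta> c * signed_indicator A B x"
proof -
  let ?z = "\<omega> ^ (q + 1)"
  have zz: "?z * (?z * x) = \<omega> ^ (2 * (q + 1)) * x" for x
    by (simp only: mult_2 power_add mult.assoc)
  have A: "?z * x \<in> A \<longleftrightarrow> x \<in> B" for x unfolding shift by auto
  have B: "?z * x \<in> B \<longleftrightarrow> x \<in> A" for x
  proof
    assume "x \<in> A"
    then obtain y where "y \<in> B" "x = ?z * y" unfolding shift by blast
    then show "?z * x \<in> B" using closed[of y] by (simp only: zz)
  next
    assume zx: "?z * x \<in> B"
    have "x = ?z * (x / ?z)" by simp
    moreover from this have "x / ?z \<in> B" using zx zz[of "x / ?z"] closed[of "x / ?z"] by (simp only:)
    ultimately show "x \<in> A" unfolding shift by blast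
  qed
  have "signed_indicator A B (\<omega> ^ ((q + 1) * i) * x) = (- 1) ^ i * signed_indicator A B x" for i
  proof (induction i)
    case (Suc i)
    have "\<omega> ^ ((q + 1) * Suc i) * x = ?z * (\<omega> ^ ((q + 1) * i) * x)"
      by (simp only: mult_Suc_right power_add mult.assoc)
    then have "signed_indicator A B (\<omega> ^ ((q + 1) * Suc i) * x) =
        - signed_indicator A B (\<omega> ^ ((q + 1) * i) * x)"
      by (simp only: signed_indicator_def A B)
    then show ?case using Suc by simp
  qed simp
  moreover obtain i where "c = \<omega> ^ ((q + 1) * i)" using assms(3) by (rule K_nonzero)
  ultimately show ?thesis by (simp only: eta_omega_power)
qed

text \<open>Equal columns would give equal adjacency matrices, hence equal relations, against
  nonemptiness and disjointness. The purpose is to obtain a nonzero Gauss sum without evaluating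
  it.\<close>

lemma first_eigenmatrix_columns_distinct:
  assumes "association_scheme d R" and "is_first_eigenmatrix d R P"
    and "i \<le> d" "i' \<le> d" "i \<noteq> i'"
  shows "\<exists>j\<le>d. P j i \<noteq> P j i'"
proof (rule ccontr)
  assume "\<not> ?thesis"
  then have cols: "P j i = P j i'" if "j \<le> d" for j using that by blast
  obtain E where E: "\<And>i. i \<le> d \<Longrightarrow> adjacency_matrix (R i) = complex_combination d (\<lambda>j. P j i) E"
    using assms(2) unfolding is_first_eigenmatrix_def by blast
  have "complex_combination d (\<lambda>j. P j i) E = complex_combination d (\<lambda>j. P j i') E"
    unfolding complex_combination_def vec_eq_iff by (auto simp: cols intro!: sum.cong)
  then have "adjacency_matrix (R i) = adjacency_matrix (R i')" using E assms(3,4) by simp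
  then have entries: "vec_nth (vec_nth (adjacency_matrix (R i)) x) y =
      vec_nth (vec_nth (adjacency_matrix (R i')) x) y" for x y by simp
  have "(x, y) \<in> R i \<longleftrightarrow> (x, y) \<in> R i'" for x y
    using entries[of x y] by (simp add: adjacency_matrix_def split: if_splits)
  then have "R i = R i'" by auto
  moreover have "R i \<noteq> {}" "R i \<inter> R i' = {}"
    using assms unfolding association_scheme_def disjoint_family_on_def by auto
  ultimately show False by simp
qed

theorem theorem6p1:
  fixes m \<tau> :: int and p f q :: nat
    and \<omega> :: "'a::{field,finite}" and X Y :: "nat \<Rightarrow> 'a set"
    and R :: "nat \<Rightarrow> ('a \<times> 'a) set" and g :: complex
  assumes "odd m"
    and "prime p" and "f > 0" and "q = p ^ f" and "int q = 2 * m\<^sup>2 - 1"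
    and "CARD('a) = q\<^sup>2"
    and "primitive_element \<omega>"
    and "X 0 = {0}"
    and "disjoint_family_on X {1..4}" and "(\<Union>i\<in>{1..4}. X i) = UNIV - {0}"
    and "X 1 = (\<lambda>x. \<omega> powi (2 * m\<^sup>2) * x) ` X 3"
    and "X 2 = (\<lambda>x. \<omega> powi (2 * m\<^sup>2) * x) ` X 4"
    and "\<forall>i\<in>{1..4}. \<exists>I. X i = (\<Union>k\<in>I. cyclotomic_class \<omega> (4 * m\<^sup>2) k)"
    and "\<forall>i\<le>4. R i = translation_relation (X i)"
    and "association_scheme 4 R"
    and "g = gauss_sum p f (quadratic_char q :: 'a \<Rightarrow> complex)"
    and "is_first_eigenmatrix 4 R (eigen_table (of_int m) g)"
    and "\<tau> \<in> {1, - 1}"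
    and "Y 0 = {0}"
    and "\<forall>j\<in>{1..4}. Y j = (\<lambda>x. \<omega> powi (- (m\<^sup>2 * \<tau>)) * x ^ q) ` X j"
    and "\<forall>j\<le>4. \<forall>a\<in>Y j. \<forall>i\<in>{1..4}.
           (\<Sum>x\<in>X i. add_char p (2 * f) (a * x)) = eigen_table (of_int m) g j i"
  shows "\<exists>H. regular_hadamard_matrix (nat (4 * m\<^sup>2)) H"
proof -
  note odd_m = assms(1) and q_m = assms(5) and prim = assms(7) and disj = assms(9)
    and cover = assms(10) and cyc = assms(13) and g_def = assms(16) and Y_def = assms(20)
    and sums = assms(21)
  obtain l where "m = 2 * l + 1" using odd_m by (rule oddE)
  then have "int q = 4 * (2 * (l\<^sup>2 + l)) + 1" using q_m by (simp add: power2_eq_square algebra_simps)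
  then have q4: "q mod 4 = 1" by presburger
  then have "odd q" by presburger
  interpret quadratic_extension \<omega> p f q
    using assms(2-4,6,7) \<open>odd q\<close> by unfold_locales
  have m_nz: "m \<noteq> 0" using odd_m by auto
  \<comment> \<open>Thus the shift \<open>2 * m\<^sup>2\<close> in the hypotheses is by a generator
    of \<open>K - {0}\<close>, and the classes of order \<open>4 * m\<^sup>2\<close> are cosets of
    the nonzero squares of \<open>K\<close>.\<close>
  have two_m2: "2 * m\<^sup>2 = int (q + 1)" "4 * m\<^sup>2 = int (2 * (q + 1))" using q_m by simp_all
  have closed: "\<omega> ^ (2 * (q + 1)) * x \<in> X i \<longleftrightarrow> x \<in> X i" if i: "i \<in> {1..4}" for i x
  proof -
    obtain I where I: "X i = (\<Union>k\<in>I. cyclotomic_class \<omega> (4 * m\<^sup>2) k)" using cyc i by blast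
    have "\<omega> ^ (2 * (q + 1)) = \<omega> powi (4 * m\<^sup>2)"
      unfolding two_m2(2) by (rule power_int_of_nat[symmetric])
    then show ?thesis unfolding I using cyclotomic_class_mult_iff[OF omega_nonzero] by simp
  qed
  have X13: "X 1 = (\<lambda>x. \<omega> ^ (q + 1) * x) ` X 3" and X24: "X 2 = (\<lambda>x. \<omega> ^ (q + 1) * x) ` X 4"
    using assms(11,12) unfolding two_m2(1) power_int_of_nat by blast+
  define \<sigma> where "\<sigma> = signed_indicator (X 1) (X 3)"
  define \<sigma>' where "\<sigma>' = signed_indicator (X 2) (X 4)"
  have odd_\<sigma>: "\<sigma> (c * x) = \<eta> c * \<sigma> x" and odd_\<sigma>': "\<sigma>' (c * x) = \<eta> c * \<sigma>' x"
    if "c \<in> K - {0}" for c x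
    unfolding \<sigma>_def \<sigma>'_def using X13 X24 closed[of 3] closed[of 4] that
    by (intro signed_indicator_odd; simp)+
  have sub: "X i \<subseteq> UNIV - {0}" if "i \<in> {1..4}" for i using cover that by blast
  have X_cases: "\<exists>i\<in>{1, 2, 3, 4}. x \<in> X i" if "x \<noteq> 0" for x
  proof -
    have "{1..4} = {1, 2, 3, 4 :: nat}" by auto
    then show ?thesis using cover that by auto
  qed
  have X_disj: "X i \<inter> X j = {}" if "i \<in> {1..4}" "j \<in> {1..4}" "i \<noteq> j" for i j
    using disj that unfolding disjoint_family_on_def by blast
  have \<sigma>_values: "x \<in> X 1 \<Longrightarrow> \<sigma> x = 1 \<and> \<sigma>' x = 0" "x \<in> X 2 \<Longrightarrow> \<sigma> x = 0 \<and> \<sigma>' x = 1"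
    "x \<in> X 3 \<Longrightarrow> \<sigma> x = - 1 \<and> \<sigma>' x = 0" "x \<in> X 4 \<Longrightarrow> \<sigma> x = 0 \<and> \<sigma>' x = - 1" for x
    using X_disj[of 1 2] X_disj[of 1 3] X_disj[of 1 4] X_disj[of 2 3] X_disj[of 2 4] X_disj[of 3 4]
    by (auto simp: \<sigma>_def \<sigma>'_def signed_indicator_def)
  \<comment> \<open>The columns 1 and 3 of the table differ only in terms containing
    \<open>g\<close>, so they would coincide for \<open>g = 0\<close>.\<close>
  have g_nz: "g \<noteq> 0"
  proof
    assume "g = 0"
    obtain j where "j \<le> 4" "eigen_table (of_int m) g j 1 \<noteq> eigen_table (of_int m) g j 3"
      using first_eigenmatrix_columns_distinct[OF assms(15,17), of 1 3] by auto
    moreover from \<open>j \<le> 4\<close> have "j \<in> {0, 1, 2, 3, 4}" by auto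
    ultimately show False using \<open>g = 0\<close> by (auto simp: eigen_table_def)
  qed
  define \<beta> where "\<beta> = \<omega> powi (- (m\<^sup>2 * \<tau>))"
  have \<beta>_nz: "\<beta> \<noteq> 0" by (simp add: \<beta>_def)
  \<comment> \<open>As \<open>m\<^sup>2\<close> is half of \<open>q + 1\<close>,
    \<open>\<beta>\<close> is \<open>u\<close> or its inverse according to the sign
    \<open>\<tau>\<close>; either way its power \<open>q - 1\<close> is -1.\<close>
  define u where "u = \<omega> ^ ((q + 1) div 2)"
  have half: "m\<^sup>2 = int ((q + 1) div 2)" using q_m by simp
  have "\<beta> = u \<or> \<beta> = inverse u"
    using assms(18) unfolding \<beta>_def u_def half by (auto simp: power_int_minus)
  moreover have "u ^ q = - u"
  proof -
    have "(q + 1) div 2 * (q - 1) = (q + 1) * ((q - 1) div 2)"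
      using \<open>odd q\<close> by (auto elim!: oddE)
    then have "u ^ (q - 1) = - 1" unfolding u_def power_mult[symmetric] by (simp only: omega_power_half)
    then show ?thesis using q_gt_1 power_minus_mult[of q u] by simp
  qed
  ultimately have \<beta>_q: "\<beta> ^ q = - \<beta>" by (auto simp: power_inverse)
  have Y_mem: "\<beta> * x ^ q \<in> Y i" if "i \<in> {1..4}" "x \<in> X i" for i x
    using Y_def that unfolding \<beta>_def by auto
  have sums': "(\<Sum>y\<in>X k. add_char p (2 * f) (\<beta> * x ^ q * y)) = eigen_table (of_int m) g i k"
    if "i \<in> {1..4}" "x \<in> X i" "k \<in> {1..4}" for i k x
    using sums Y_mem[OF that(1,2)] that(1,3) by simp
  \<comment> \<open>Subtracting columns 1 and 3, or 2 and 4, removes the terms of the table free of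
    \<open>g\<close>, and the signed character sum on the left is an integer times
    \<open>g\<close>.\<close>
  have table: "of_int (\<Sum>j<q + 1. \<eta> (tr (\<beta> * x ^ q * \<omega> ^ j)) * \<sigma> (\<omega> ^ j)) * g =
        eigen_table (of_int m) g i 1 - eigen_table (of_int m) g i 3"
      "of_int (\<Sum>j<q + 1. \<eta> (tr (\<beta> * x ^ q * \<omega> ^ j)) * \<sigma>' (\<omega> ^ j)) * g =
        eigen_table (of_int m) g i 2 - eigen_table (of_int m) g i 4"
    if i: "i \<in> {1..4}" "x \<in> X i" for i x
  proof -
    show "of_int (\<Sum>j<q + 1. \<eta> (tr (\<beta> * x ^ q * \<omega> ^ j)) * \<sigma> (\<omega> ^ j)) * g =
        eigen_table (of_int m) g i 1 - eigen_table (of_int m) g i 3"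
      using sum_odd_add_char[of \<sigma> "\<beta> * x ^ q", OF odd_\<sigma>, folded g_def]
        sum_signed_indicator[OF sub[of 1] sub[of 3], of "\<lambda>y. add_char p (2 * f) (\<beta> * x ^ q * y)",
          folded \<sigma>_def] sums'[OF i, of 1] sums'[OF i, of 3]
      by simp
    show "of_int (\<Sum>j<q + 1. \<eta> (tr (\<beta> * x ^ q * \<omega> ^ j)) * \<sigma>' (\<omega> ^ j)) * g =
        eigen_table (of_int m) g i 2 - eigen_table (of_int m) g i 4"
      using sum_odd_add_char[of \<sigma>' "\<beta> * x ^ q", OF odd_\<sigma>', folded g_def]
        sum_signed_indicator[OF sub[of 2] sub[of 4], of "\<lambda>y. add_char p (2 * f) (\<beta> * x ^ q * y)",
          folded \<sigma>'_def] sums'[OF i, of 2] sums'[OF i, of 4]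
      by simp
  qed
  \<comment> \<open>Dividing by \<open>g\<close> turns the complex table entries into the integer
    row equations; the rows 3 and 4 are the rows 1 and 2 with both signs reversed.\<close>
  have cancel: "n = r" if "of_int n * g = of_int r * g" for n r :: int
    using that g_nz by simp
  have "\<exists>H. regular_hadamard_matrix (2 * (q + 1)) H"
  proof (rule regular_hadamard_matrix_from_odd_functions[OF q4 m_nz \<beta>_nz \<beta>_q, of \<sigma> \<sigma>'])
    fix x :: 'a assume "x \<noteq> 0"
    then obtain i where i: "i \<in> {1, 2, 3, 4}" "x \<in> X i" using X_cases by blast
    then show "(\<sigma> x, \<sigma>' x) \<in> {(1, 0), (- 1, 0), (0, 1), (0, - 1)}"
      using \<sigma>_values[of x] by auto
    have i': "i \<in> {1..4}" using i by auto
    show "(\<Sum>j<q + 1. \<eta> (tr (\<beta> * x ^ q * \<omega> ^ j)) * \<sigma> (\<omega> ^ j)) = - m * \<sigma> x - (m - 1) * \<sigma>' x"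
      by (rule cancel, subst table(1)[OF i' i(2)])
        (use i \<sigma>_values[of x] in \<open>auto simp: eigen_table_def field_simps\<close>)
    show "(\<Sum>j<q + 1. \<eta> (tr (\<beta> * x ^ q * \<omega> ^ j)) * \<sigma>' (\<omega> ^ j)) = - (m + 1) * \<sigma> x + m * \<sigma>' x"
      by (rule cancel, subst table(2)[OF i' i(2)])
        (use i \<sigma>_values[of x] in \<open>auto simp: eigen_table_def field_simps\<close>)
  qed
  moreover have "nat (4 * m\<^sup>2) = 2 * (q + 1)" unfolding two_m2(2) by (rule nat_int)
  ultimately show ?thesis by simp
qed

end
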